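(* For all integers $b\ge 1$, \[ F(b)<\tfrac12\, g(b+1)-b. \]
   Context: All games are short normal-play two-player combinatorial games (Left and Right; a player unable to move loses), compared up to equality ($Y=Z$ iff $X+Y$ and $X+Z$ have the same outcome for every game $X$, $+$ being the disjunctive sum). The birthday of a game is the maximum length of a sequence of moves (not necessarily alternating) starting from it; a value is born by day $b$ if it equals some game of birthday at most $b$; $\mathbb{G}_b$ is the set of values born by day $b$ and $g(b)=|\mathbb{G}_b|$. A Digraph placement game is played on a finite digraph with vertices coloured blue/red (not necessarily properly): Left chooses a remaining blue vertex and deletes it with all its out-neighbours, Right does the same with a red vertex; a player unable to move loses. For a game $X$, $f(X)$ is the least $n$ such that some Digraph placement game on $n$ vertices equals $X$, and $F(b)=\max_{X\in\mathbb{G}_b}f(X)$. *)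

theory Defs
  imports Complex_Main "HOL-Library.FSet" "Graph_Theory.Pair_Digraph"
begin

section \<open>Short normal-play games\<close>

datatype player = Left | Right

primrec opponent :: "player \<Rightarrow> player" where
  "opponent Left = Right"
| "opponent Right = Left"

datatype game = Game (options_left: "game fset") (options_right: "game fset")

primrec options :: "player \<Rightarrow> game \<Rightarrow> game fset" where
  "options Left X = options_left X"
| "options Right X = options_right X"

definition move :: "game \<Rightarrow> game \<Rightarrow> bool" where
  "move X Y \<longleftrightarrow> (\<exists>p. Y |\<in>| options p X)"

lemma moveI: "Y |\<in>| options p X \<Longrightarrow> move X Y"
  by (auto simp: move_def)

lemma wf_move: "wf {(Y, X). move X Y}"
proof (rule wfUNIVI)
  fix P :: "game \<Rightarrow> bool" and X
  assume *: "\<forall>X. (\<forall>Y. (Y, X) \<in> {(Y, X). move X Y} \<longrightarrow> P Y) \<longrightarrow> P X"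
  show "P X"
  proof (induction X)
    case (Game L R)
    have "P Y" if m: "move (Game L R) Y" for Y
    proof -
      from m obtain p where "Y |\<in>| options p (Game L R)"
        by (auto simp: move_def)
      then show ?thesis
        using Game by (cases p) auto
    qed
    with * show ?case
      by blast
  qed
qed

text \<open>\<open>wins_first p X\<close>: player \<open>p\<close> wins \<open>X\<close> when moving first;
  a player who has no option loses.\<close>

function wins_first :: "player \<Rightarrow> game \<Rightarrow> bool" where
  "wins_first p X \<longleftrightarrow> (\<exists>Y \<in> fset (options p X). \<not> wins_first (opponent p) Y)"
  by auto
termination
  by (relation "inv_image {(Y, X). move X Y} snd")
    (auto intro: wf_inv_image wf_move moveI)

declare wins_first.simps [simp del]

text \<open>The outcome of a game says, for either choice of the player who starts, who wins.\<close>

definition outcome :: "game \<Rightarrow> player \<Rightarrow> player" where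
  "outcome X p = (if wins_first p X then p else opponent p)"

function disjunctive_sum :: "game \<Rightarrow> game \<Rightarrow> game"  (infixl "\<oplus>\<^sub>g" 65) where
  "X \<oplus>\<^sub>g Y =
     Game ((\<lambda>X'. X' \<oplus>\<^sub>g Y) |`| options_left X |\<union>| (\<lambda>Y'. X \<oplus>\<^sub>g Y') |`| options_left Y)
          ((\<lambda>X'. X' \<oplus>\<^sub>g Y) |`| options_right X |\<union>| (\<lambda>Y'. X \<oplus>\<^sub>g Y') |`| options_right Y)"
  by auto
termination
  by (relation "{(Y, X). move X Y} <*lex*> {(Y, X). move X Y}")
    (auto intro: wf_lex_prod wf_move moveI[of _ Left] moveI[of _ Right])

declare disjunctive_sum.simps [simp del]

definition game_eq :: "game \<Rightarrow> game \<Rightarrow> bool" where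
  "game_eq Y Z \<longleftrightarrow> (\<forall>X. outcome (X \<oplus>\<^sub>g Y) = outcome (X \<oplus>\<^sub>g Z))"

quotient_type game_value = game / game_eq
  morphisms rep_value value_of
  by (rule equivpI) (auto simp: reflp_def symp_def transp_def game_eq_def)

definition birthday :: "game \<Rightarrow> nat" where
  "birthday X = Max {n. \<exists>Y. (move ^^ n) X Y}"

definition born_by :: "nat \<Rightarrow> game_value set" where
  "born_by b = value_of ` {X. birthday X \<le> b}"

definition num_born_by :: "nat \<Rightarrow> nat" where
  "num_born_by b = card (born_by b)"

section \<open>Digraph placement games\<close>

datatype colour = Blue | Red

text \<open>The position in which \<open>S\<close> is the set of vertices of \<open>G\<close> that have not been deleted yet.
  Deleting \<open>v\<close> and its out-neighbours leaves \<open>ffilter (\<lambda>w. w \<noteq> v \<and> (v, w) \<notin> parcs G) S\<close>.\<close>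

function placement_position ::
    "'a pair_pre_digraph \<Rightarrow> ('a \<Rightarrow> colour) \<Rightarrow> 'a fset \<Rightarrow> game" where
  "placement_position G c S =
     Game ((\<lambda>v. placement_position G c (ffilter (\<lambda>w. w \<noteq> v \<and> (v, w) \<notin> parcs G) S))
             |`| ffilter (\<lambda>v. c v = Blue) S)
          ((\<lambda>v. placement_position G c (ffilter (\<lambda>w. w \<noteq> v \<and> (v, w) \<notin> parcs G) S))
             |`| ffilter (\<lambda>v. c v = Red) S)"
  by auto
termination
  by (relation "measure (\<lambda>(G, c, S). fcard S)")
    (auto intro!: pfsubset_fcard_mono)

declare placement_position.simps [simp del]

text \<open>Vertices are natural numbers, which covers all finite digraphs up to isomorphism.
  Left moves at blue vertices, Right at red ones.\<close>

definition is_placement_value :: "nat \<Rightarrow> game_value \<Rightarrow> bool" where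
  "is_placement_value n x \<longleftrightarrow>
     (\<exists>(G :: nat pair_pre_digraph) c S.
        pair_digraph G \<and> fset S = pverts G \<and> card (pverts G) = n \<and>
        value_of (placement_position G c S) = x)"

text \<open>\<open>LEAST\<close> is meaningful only for values of placement games; no default is built in
  for other values, so a bound on \<open>min_vertices\<close> has to establish that such a game exists.\<close>

definition min_vertices :: "game_value \<Rightarrow> nat" where
  "min_vertices x = (LEAST n. is_placement_value n x)"

definition max_min_vertices :: "nat \<Rightarrow> nat" where
  "max_min_vertices b = Max (min_vertices ` born_by b)"

end

theory Submission
  imports Defs
begin

text \<open>
  Upper bound. Suppose that every value born by day \<open>b\<close> is realised by an induced subgraph of
  one digraph \<open>U\<close>. For each such value \<open>y\<close> add a blue and a red vertex that delete everything
  except a copy of \<open>y\<close> inside \<open>U\<close>. A value \<open>X\<close> born by day \<open>b + 1\<close> is then realised by \<open>U\<close>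
  together with the new vertices that belong to the options of \<open>X\<close>, provided that a first
  move inside \<open>U\<close> does not matter. This is enforced by four classes of \<open>b + 2\<close> guard
  vertices: every first move in \<open>U\<close> or at a guard leaves the opponent a reply after which only
  \<open>b + 1\<close> guards of the opponent's colour are left, so that it is a gift horse. As all values
  share \<open>U\<close>, this adds only \<open>2 g(b) + 4(b + 2)\<close> vertices for each day, and \<open>F(b + 1)\<close> is at most
  linear in \<open>g(b)\<close>. The empty \<open>U\<close> of day 0 needs no guards; for \<open>b = 2\<close> the bound depends on this.

  Lower bound. For antichains \<open>A\<close>, \<open>A'\<close> of games born by day \<open>b\<close>, consider the games
  \<open>{b, {b | A} | -b, -{b | A'}}\<close>, where the second option on either side may also be missing. The
  threats \<open>b\<close> and \<open>-b\<close> are so large that no option is reversible, and these games are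
  pairwise different. With the empty antichain, the singletons, and \<open>{0, *}\<close> for \<open>b \<ge> 1\<close>, this
  gives \<open>g(b + 2) \<ge> (g(b) + 3)\<^sup>2\<close>, so \<open>g(b + 2)\<close> exceeds every linear bound in \<open>g(b)\<close>.
\<close>

section \<open>Birthdays\<close>

lemma opponent_opponent [simp]: "opponent (opponent p) = p"
  by (cases p) auto

lemma opponent_neq [simp]: "opponent p \<noteq> p" "p \<noteq> opponent p"
  by (cases p; simp)+

text \<open>\<open>birthday\<close> is a \<open>Max\<close> and tells something only for a finite
  set. A run from \<open>X\<close> is empty or consists of one move and a run from one of finitely
  many options, so well-founded induction applies.\<close>

lemma finite_run_lengths: "finite {n. \<exists>Y. (move ^^ n) X Y}"
proof (induction X rule: wf_induct_rule[OF wf_move])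
  case (1 X)
  have "{Y. move X Y} = fset (options Left X) \<union> fset (options Right X)"
    by (auto simp: move_def) (metis options.simps player.exhaust)+
  then have "finite {Y. move X Y}" by simp
  then have "finite (insert 0 (Suc ` (\<Union>Y\<in>{Y. move X Y}. {n. \<exists>Z. (move ^^ n) Y Z})))"
    using 1 by auto
  moreover have "{n. \<exists>Y. (move ^^ n) X Y}
      \<subseteq> insert 0 (Suc ` (\<Union>Y\<in>{Y. move X Y}. {n. \<exists>Z. (move ^^ n) Y Z}))"
  proof
    fix n assume "n \<in> {n. \<exists>Y. (move ^^ n) X Y}"
    then obtain Y where Y: "(move ^^ n) X Y" by auto
    show "n \<in> insert 0 (Suc ` (\<Union>Y\<in>{Y. move X Y}. {n. \<exists>Z. (move ^^ n) Y Z}))"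
    proof (cases n)
      case (Suc m)
      with Y obtain Z where "move X Z" "(move ^^ m) Z Y" by (metis relpowp_Suc_E2)
      with Suc show ?thesis by auto
    qed simp
  qed
  ultimately show ?case by (rule rev_finite_subset)
qed

lemma birthday_le_iff: "birthday X \<le> n \<longleftrightarrow> (\<forall>m Y. (move ^^ m) X Y \<longrightarrow> m \<le> n)"
proof -
  have "(move ^^ 0) X X" by simp
  then have "{n. \<exists>Y. (move ^^ n) X Y} \<noteq> {}" by blast
  then show ?thesis
    unfolding birthday_def by (subst Max_le_iff[OF finite_run_lengths]) auto
qed

lemma birthday_le_Suc_iff:
  "birthday X \<le> Suc n \<longleftrightarrow> (\<forall>p. \<forall>Y \<in> fset (options p X). birthday Y \<le> n)"
proof
  assume *: "birthday X \<le> Suc n"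
  show "\<forall>p. \<forall>Y \<in> fset (options p X). birthday Y \<le> n"
    unfolding birthday_le_iff
  proof (intro allI ballI impI)
    fix p Y m Z
    assume "Y |\<in>| options p X" "(move ^^ m) Y Z"
    then have "(move ^^ Suc m) X Z" by (metis moveI relpowp_Suc_I2)
    with * show "m \<le> n" unfolding birthday_le_iff by blast
  qed
next
  assume *: "\<forall>p. \<forall>Y \<in> fset (options p X). birthday Y \<le> n"
  show "birthday X \<le> Suc n"
    unfolding birthday_le_iff
  proof (intro allI impI)
    fix m Z
    assume "(move ^^ m) X Z"
    then show "m \<le> Suc n"
    proof (cases m)
      case (Suc k)
      then obtain Y where "move X Y" "(move ^^ k) Y Z"
        using \<open>(move ^^ m) X Z\<close> by (metis relpowp_Suc_E2)
      with * Suc show ?thesis unfolding move_def birthday_le_iff by auto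
    qed simp
  qed
qed

lemma birthday_option: "Y |\<in>| options p X \<Longrightarrow> birthday Y < birthday X"
proof (cases "birthday X")
  case 0
  assume "Y |\<in>| options p X"
  then have "(move ^^ 1) X Y" by (auto intro: moveI)
  with 0 show ?thesis by (metis birthday_le_iff le_zero_eq one_neq_zero)
next
  case (Suc n)
  assume "Y |\<in>| options p X"
  with Suc show ?thesis by (metis birthday_le_Suc_iff le_imp_less_Suc order_refl)
qed

lemma birthday_option_left: "Y |\<in>| options_left X \<Longrightarrow> birthday Y < birthday X"
  and birthday_option_right: "Y |\<in>| options_right X \<Longrightarrow> birthday Y < birthday X"
  using birthday_option[of Y Left X] birthday_option[of Y Right X] by auto

lemma birthday_eq_0_iff: "birthday X = 0 \<longleftrightarrow> X = Game {||} {||}"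
proof
  assume "birthday X = 0"
  then have "options_left X = {||}" "options_right X = {||}"
    using birthday_option_left birthday_option_right by fastforce+
  then show "X = Game {||} {||}" by (cases X) auto
next
  assume "X = Game {||} {||}"
  then have "\<not> move X Y" for Y
    unfolding move_def using options.simps by (metis bot_fset.rep_eq empty_iff game.sel player.exhaust)
  then have "birthday X \<le> 0"
    unfolding birthday_le_iff by (metis le_zero_eq not0_implies_Suc relpowp_Suc_E2)
  then show "birthday X = 0" by simp
qed

text \<open>A game of birthday at most n + 1 is determined by two sets of games of birthday at most
  n. The finiteness gives \<open>card\<close> and \<open>Max\<close> their meaning in
  \<open>num_born_by\<close> and \<open>max_min_vertices\<close>.\<close>

lemma finite_birthday_le: "finite {X. birthday X \<le> n}"
proof (induction n)
  case 0
  then show ?case by (simp add: birthday_eq_0_iff)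
next
  case (Suc n)
  let ?A = "{X. birthday X \<le> n}"
  have "finite (fset ` {L. fset L \<subseteq> ?A})"
    by (rule finite_subset[of _ "Pow ?A"]) (use Suc in auto)
  then have "finite {L. fset L \<subseteq> ?A}"
    by (rule finite_imageD) (simp add: inj_on_def fset_inject)
  moreover have "{X. birthday X \<le> Suc n}
      \<subseteq> (\<lambda>(L, R). Game L R) ` ({L. fset L \<subseteq> ?A} \<times> {L. fset L \<subseteq> ?A})"
  proof
    fix X assume X: "X \<in> {X. birthday X \<le> Suc n}"
    then have "\<forall>Y \<in> fset (options Left X). birthday Y \<le> n"
        "\<forall>Y \<in> fset (options Right X). birthday Y \<le> n"
      unfolding mem_Collect_eq birthday_le_Suc_iff by blast+
    then show "X \<in> (\<lambda>(L, R). Game L R) ` ({L. fset L \<subseteq> ?A} \<times> {L. fset L \<subseteq> ?A})"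
      by (intro image_eqI[where x = "(options_left X, options_right X)"]) auto
  qed
  ultimately show ?case by (meson finite_SigmaI finite_imageI finite_subset)
qed

lemma finite_born_by [simp]: "finite (born_by b)"
  by (simp add: born_by_def finite_birthday_le)

section \<open>The order of games\<close>

text \<open>Conway's recursive order. Equality of values is defined through outcomes of sums;
  \<open>game_eq_iff\<close> links the two, so that values can be compared by looking at options
  only.\<close>

function game_le :: "game \<Rightarrow> game \<Rightarrow> bool" (infix "\<le>\<^sub>g" 50) where
  "X \<le>\<^sub>g Y \<longleftrightarrow> (\<forall>X' \<in> fset (options_left X). \<not> Y \<le>\<^sub>g X') \<and>
    (\<forall>Y' \<in> fset (options_right Y). \<not> Y' \<le>\<^sub>g X)"
  by auto
termination
  by (relation "measure (\<lambda>(X, Y). birthday X + birthday Y)")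
    (auto dest: birthday_option_left birthday_option_right)

declare game_le.simps [simp del]

lemma wins_first_Left_sum:
  "wins_first Left (X \<oplus>\<^sub>g Y) \<longleftrightarrow>
    (\<exists>X' \<in> fset (options_left X). \<not> wins_first Right (X' \<oplus>\<^sub>g Y)) \<or>
    (\<exists>Y' \<in> fset (options_left Y). \<not> wins_first Right (X \<oplus>\<^sub>g Y'))"
  by (subst wins_first.simps, subst disjunctive_sum.simps) auto

lemma wins_first_Right_sum:
  "wins_first Right (X \<oplus>\<^sub>g Y) \<longleftrightarrow>
    (\<exists>X' \<in> fset (options_right X). \<not> wins_first Left (X' \<oplus>\<^sub>g Y)) \<or>
    (\<exists>Y' \<in> fset (options_right Y). \<not> wins_first Left (X \<oplus>\<^sub>g Y'))"
  by (subst wins_first.simps, subst disjunctive_sum.simps) auto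

text \<open>Both claims go by one induction, as each move passes the turn. Suppose Right wins
  \<open>Z + Y\<close> by moving to \<open>Y'\<close>. As \<open>Y'\<close> is not below
  \<open>X\<close>, either Left can answer with some \<open>Y''\<close> above \<open>X\<close>, and
  then Right wins first at \<open>Z + Y''\<close> and by induction at \<open>Z + X\<close>, or Right
  has a move from \<open>X\<close> to some \<open>X'\<close> below \<open>Y'\<close>. The claim for
  Left is dual.\<close>

lemma wins_first_mono:
  assumes "X \<le>\<^sub>g Y"
  shows "(wins_first Right (Z \<oplus>\<^sub>g Y) \<longrightarrow> wins_first Right (Z \<oplus>\<^sub>g X)) \<and>
    (wins_first Left (Z \<oplus>\<^sub>g X) \<longrightarrow> wins_first Left (Z \<oplus>\<^sub>g Y))"
  using assms
proof (induction "birthday X + birthday Y + birthday Z" arbitrary: X Y Z rule: less_induct)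
  case less
  note bd = birthday_option_left birthday_option_right
  have left: "\<not> Y \<le>\<^sub>g X'" if "X' |\<in>| options_left X" for X'
    using less.prems that by (subst (asm) game_le.simps) auto
  have right: "\<not> Y' \<le>\<^sub>g X" if "Y' |\<in>| options_right Y" for Y'
    using less.prems that by (subst (asm) game_le.simps) auto
  show ?case
  proof (intro conjI impI)
    assume "wins_first Right (Z \<oplus>\<^sub>g Y)"
    then consider Z' where "Z' |\<in>| options_right Z" "\<not> wins_first Left (Z' \<oplus>\<^sub>g Y)"
      | Y' where "Y' |\<in>| options_right Y" "\<not> wins_first Left (Z \<oplus>\<^sub>g Y')"
      unfolding wins_first_Right_sum by blast
    then show "wins_first Right (Z \<oplus>\<^sub>g X)"
    proof cases
      case 1
      have "\<not> wins_first Left (Z' \<oplus>\<^sub>g X)"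
        using less.hyps[of X Y Z'] less.prems 1 bd by force
      with 1 show ?thesis by (subst wins_first_Right_sum) auto
    next
      case 2
      from right[OF 2(1)] consider
          Y'' where "Y'' |\<in>| options_left Y'" "X \<le>\<^sub>g Y''"
        | X' where "X' |\<in>| options_right X" "X' \<le>\<^sub>g Y'"
        by (subst (asm) game_le.simps) auto
      then show ?thesis
      proof cases
        case a: 1
        have "birthday Y'' < birthday Y" using a 2 bd by (meson less_trans)
        moreover have "wins_first Right (Z \<oplus>\<^sub>g Y'')"
          using 2 a by (subst (asm) wins_first_Left_sum) auto
        ultimately show ?thesis using less.hyps[of X Y'' Z] a by auto
      next
        case b: 2
        have "birthday X' < birthday X" "birthday Y' < birthday Y" using b 2 bd by auto
        then have "\<not> wins_first Left (Z \<oplus>\<^sub>g X')"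
          using less.hyps[of X' Y' Z] b 2 by auto
        with b show ?thesis by (subst wins_first_Right_sum) auto
      qed
    qed
  next
    assume "wins_first Left (Z \<oplus>\<^sub>g X)"
    then consider Z' where "Z' |\<in>| options_left Z" "\<not> wins_first Right (Z' \<oplus>\<^sub>g X)"
      | X' where "X' |\<in>| options_left X" "\<not> wins_first Right (Z \<oplus>\<^sub>g X')"
      unfolding wins_first_Left_sum by blast
    then show "wins_first Left (Z \<oplus>\<^sub>g Y)"
    proof cases
      case 1
      have "\<not> wins_first Right (Z' \<oplus>\<^sub>g Y)"
        using less.hyps[of X Y Z'] less.prems 1 bd by force
      with 1 show ?thesis by (subst wins_first_Left_sum) auto
    next
      case 2
      from left[OF 2(1)] consider
          X'' where "X'' |\<in>| options_right X'" "X'' \<le>\<^sub>g Y"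
        | Y' where "Y' |\<in>| options_left Y" "X' \<le>\<^sub>g Y'"
        by (subst (asm) game_le.simps) auto
      then show ?thesis
      proof cases
        case a: 1
        have "birthday X'' < birthday X" using a 2 bd by (meson less_trans)
        moreover have "wins_first Left (Z \<oplus>\<^sub>g X'')"
          using 2 a by (subst (asm) wins_first_Right_sum) auto
        ultimately show ?thesis using less.hyps[of X'' Y Z] a by auto
      next
        case b: 2
        have "birthday Y' < birthday Y" "birthday X' < birthday X" using b 2 bd by auto
        then have "\<not> wins_first Right (Z \<oplus>\<^sub>g Y')"
          using less.hyps[of X' Y' Z] b 2 by auto
        with b show ?thesis by (subst wins_first_Left_sum) auto
      qed
    qed
  qed
qed

section \<open>Negatives, and the order as the outcome of a difference\<close>

primrec negate :: "game \<Rightarrow> game" where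
  "negate (Game L R) = Game (negate |`| R) (negate |`| L)"

lemma options_negate [simp]:
  "options_left (negate X) = negate |`| options_right X"
  "options_right (negate X) = negate |`| options_left X"
  by (cases X; simp)+

lemma negate_negate [simp]: "negate (negate X) = X"
proof (induction X)
  case (Game L R)
  then show ?case by (auto simp: fimage_fimage intro!: fset_eqI)
qed

lemma game_le_negate: "negate X \<le>\<^sub>g negate Y \<longleftrightarrow> Y \<le>\<^sub>g X"
proof (induction "birthday X + birthday Y" arbitrary: X Y rule: less_induct)
  case less
  have "negate Y \<le>\<^sub>g negate X' \<longleftrightarrow> X' \<le>\<^sub>g Y" if "X' |\<in>| options_right X" for X'
    using less.hyps[of Y X'] birthday_option_right[OF that] by simp
  moreover have "negate Y' \<le>\<^sub>g negate X \<longleftrightarrow> X \<le>\<^sub>g Y'" if "Y' |\<in>| options_left Y" for Y'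
    using less.hyps[of Y' X] birthday_option_left[OF that] by simp
  ultimately show ?case
    unfolding game_le.simps[of "negate X"] game_le.simps[of Y] by auto
qed

lemma birthday_negate_le: "birthday X \<le> n \<Longrightarrow> birthday (negate X) \<le> n"
proof (induction n arbitrary: X)
  case 0
  then show ?case by (auto simp: birthday_eq_0_iff)
next
  case (Suc n)
  have "birthday Y \<le> n" if "Y |\<in>| options p (negate X)" for p Y
  proof -
    from that obtain Z q where "Y = negate Z" "Z |\<in>| options q X"
      by (cases p) (auto, metis options.simps(2), metis options.simps(1))
    then show ?thesis using Suc by (metis birthday_le_Suc_iff)
  qed
  then show ?case by (auto simp: birthday_le_Suc_iff)
qed

lemma birthday_negate [simp]: "birthday (negate X) = birthday X"
  using birthday_negate_le[of X] birthday_negate_le[of "negate X"] by (simp add: le_antisym)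

text \<open>The recursion for the order and the recursion for winning the difference
  \<open>Y - X\<close> are the same. The two halves are proved together because unfolding one of
  them leads to the other.\<close>

lemma game_le_iff_wins_first:
  "(X \<le>\<^sub>g Y \<longleftrightarrow> \<not> wins_first Right (negate X \<oplus>\<^sub>g Y)) \<and>
   (Y \<le>\<^sub>g X \<longleftrightarrow> \<not> wins_first Left (negate X \<oplus>\<^sub>g Y))"
proof (induction "birthday X + birthday Y" arbitrary: X Y rule: less_induct)
  case less
  have 1: "(X' \<le>\<^sub>g Y \<longleftrightarrow> \<not> wins_first Right (negate X' \<oplus>\<^sub>g Y)) \<and>
      (Y \<le>\<^sub>g X' \<longleftrightarrow> \<not> wins_first Left (negate X' \<oplus>\<^sub>g Y))"
    if "X' |\<in>| options_left X \<or> X' |\<in>| options_right X" for X'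
    using that less.hyps[of X' Y] birthday_option_left birthday_option_right by fastforce
  have 2: "(X \<le>\<^sub>g Y' \<longleftrightarrow> \<not> wins_first Right (negate X \<oplus>\<^sub>g Y')) \<and>
      (Y' \<le>\<^sub>g X \<longleftrightarrow> \<not> wins_first Left (negate X \<oplus>\<^sub>g Y'))"
    if "Y' |\<in>| options_left Y \<or> Y' |\<in>| options_right Y" for Y'
    using that less.hyps[of X Y'] birthday_option_left birthday_option_right by fastforce
  have "X \<le>\<^sub>g Y \<longleftrightarrow> \<not> wins_first Right (negate X \<oplus>\<^sub>g Y)"
    unfolding game_le.simps[of X Y] wins_first_Right_sum using 1 2 by auto
  moreover have "Y \<le>\<^sub>g X \<longleftrightarrow> \<not> wins_first Left (negate X \<oplus>\<^sub>g Y)"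
    unfolding game_le.simps[of Y X] wins_first_Left_sum using 1 2 by auto
  ultimately show ?case ..
qed

lemma game_le_refl [simp]: "X \<le>\<^sub>g X"
proof (induction "birthday X" arbitrary: X rule: less_induct)
  case less
  have "\<not> X \<le>\<^sub>g X'" if "X' |\<in>| options_left X" for X'
    using less[OF birthday_option_left[OF that]] that by (subst game_le.simps) auto
  moreover have "\<not> X' \<le>\<^sub>g X" if "X' |\<in>| options_right X" for X'
    using less[OF birthday_option_right[OF that]] that by (subst game_le.simps) auto
  ultimately show ?case by (subst game_le.simps) auto
qed

text \<open>Monotonicity of sums in the context \<open>-X\<close>: if Right cannot win first at
  \<open>Y - X\<close>, then neither at \<open>Z - X\<close>.\<close>

lemma game_le_trans: "X \<le>\<^sub>g Y \<Longrightarrow> Y \<le>\<^sub>g Z \<Longrightarrow> X \<le>\<^sub>g Z"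
  using wins_first_mono[of Y Z "negate X"] game_le_iff_wins_first by blast

section \<open>Equality of values in terms of the order\<close>

lemma not_game_le_left: "X' |\<in>| options_left X \<Longrightarrow> \<not> X \<le>\<^sub>g X'"
  and not_game_le_right: "X' |\<in>| options_right X \<Longrightarrow> \<not> X' \<le>\<^sub>g X"
  using game_le.simps[of X X] by auto

lemma outcome_eq_iff: "outcome X = outcome Y \<longleftrightarrow> (\<forall>p. wins_first p X = wins_first p Y)"
  by (auto simp: outcome_def fun_eq_iff)

text \<open>For one direction the single context \<open>-X\<close> suffices, since
  \<open>X - X\<close> is lost by whoever starts. The other direction is monotonicity in every
  context.\<close>

lemma game_eq_iff: "game_eq X Y \<longleftrightarrow> X \<le>\<^sub>g Y \<and> Y \<le>\<^sub>g X"
proof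
  assume "game_eq X Y"
  then have *: "wins_first p (Z \<oplus>\<^sub>g X) = wins_first p (Z \<oplus>\<^sub>g Y)" for p Z
    by (simp add: game_eq_def outcome_eq_iff)
  have "X \<le>\<^sub>g X" by simp
  then show "X \<le>\<^sub>g Y \<and> Y \<le>\<^sub>g X"
    using game_le_iff_wins_first[of X X] game_le_iff_wins_first[of X Y] * by auto
next
  assume "X \<le>\<^sub>g Y \<and> Y \<le>\<^sub>g X"
  then have "wins_first p (Z \<oplus>\<^sub>g X) = wins_first p (Z \<oplus>\<^sub>g Y)" for p Z
    using wins_first_mono[of X Y Z] wins_first_mono[of Y X Z] by (cases p) auto
  then show "game_eq X Y" by (simp add: game_eq_def outcome_eq_iff)
qed

lemma value_of_eq_iff: "value_of X = value_of Y \<longleftrightarrow> X \<le>\<^sub>g Y \<and> Y \<le>\<^sub>g X"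
  by (simp add: game_value.abs_eq_iff game_eq_iff)

section \<open>A lower bound for the number of values\<close>

primrec integer :: "nat \<Rightarrow> game" where
  "integer 0 = Game {||} {||}"
| "integer (Suc n) = Game {|integer n|} {||}"

lemma birthday_integer: "birthday (integer n) \<le> n"
proof (induction n)
  case 0
  then show ?case by (simp add: birthday_eq_0_iff)
next
  case (Suc n)
  then show ?case unfolding birthday_le_Suc_iff
    by (metis bot_fset.rep_eq empty_iff finsert.rep_eq game.sel insert_iff integer.simps(2)
        options.simps player.exhaust)
qed

lemma options_right_integer [simp]: "options_right (integer n) = {||}"
  by (cases n) auto

text \<open>Left's moves are matched by the move from n + 1 to n, and Right has no move in an
  integer. Thus \<open>integer n\<close> is the greatest game born by day n.\<close>

lemma game_le_integer: "birthday X \<le> n \<Longrightarrow> X \<le>\<^sub>g integer n"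
proof (induction n arbitrary: X)
  case 0
  then show ?case by (simp add: birthday_eq_0_iff)
next
  case (Suc n)
  have "\<not> integer (Suc n) \<le>\<^sub>g X'" if "X' |\<in>| options_left X" for X'
  proof -
    have "birthday X' \<le> n" using Suc.prems birthday_option_left[OF that] by simp
    from Suc.IH[OF this] show ?thesis by (subst game_le.simps) auto
  qed
  then show ?case by (subst game_le.simps) auto
qed

lemma negate_integer_le: "birthday X \<le> n \<Longrightarrow> negate (integer n) \<le>\<^sub>g X"
  using game_le_integer[of "negate X" n] game_le_negate[of "integer n" "negate X"] by simp

definition left_threat :: "nat \<Rightarrow> game fset \<Rightarrow> game" where
  "left_threat b A = Game {|integer b|} A"

text \<open>The set \<open>R\<close> is given without its sign, so that negation merely swaps
  \<open>L\<close> and \<open>R\<close>; results about Left's options then carry over to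
  Right's.\<close>

definition double_threat :: "nat \<Rightarrow> game fset \<Rightarrow> game fset \<Rightarrow> game" where
  "double_threat b L R =
     Game (finsert (integer b) L) (finsert (negate (integer b)) (negate |`| R))"

lemma birthday_left_threat:
  assumes "\<And>X. X |\<in>| A \<Longrightarrow> birthday X \<le> b"
  shows "birthday (left_threat b A) \<le> Suc b"
  unfolding birthday_le_Suc_iff
proof (intro allI ballI)
  fix p Y assume "Y |\<in>| options p (left_threat b A)"
  then show "birthday Y \<le> b"
    using assms birthday_integer by (cases p) (auto simp: left_threat_def)
qed

lemma birthday_double_threat:
  assumes "\<And>X. X |\<in>| L \<Longrightarrow> birthday X \<le> Suc b" "\<And>X. X |\<in>| R \<Longrightarrow> birthday X \<le> Suc b"
  shows "birthday (double_threat b L R) \<le> Suc (Suc b)"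
  unfolding birthday_le_Suc_iff[of _ "Suc b"]
proof (intro allI ballI)
  fix p Y assume "Y |\<in>| options p (double_threat b L R)"
  then show "birthday Y \<le> Suc b"
    using assms birthday_integer[of b] by (cases p) (auto simp: double_threat_def)
qed

lemma not_left_threat_le: "birthday X \<le> b \<Longrightarrow> \<not> left_threat b A \<le>\<^sub>g X"
  using game_le_integer[of X b] by (subst game_le.simps) (auto simp: left_threat_def)

text \<open>Left's move to b exceeds everything in \<open>A\<close> and \<open>B\<close>, so only
  Right's options decide. The threats therefore compare by the up-sets that \<open>A\<close> and
  \<open>B\<close> generate.\<close>

lemma left_threat_le_iff:
  assumes "\<And>X. X |\<in>| B \<Longrightarrow> birthday X \<le> b"
  shows "left_threat b A \<le>\<^sub>g left_threat b B \<longleftrightarrow> (\<forall>X \<in> fset B. \<exists>Y \<in> fset A. Y \<le>\<^sub>g X)"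
proof -
  have "X \<le>\<^sub>g left_threat b A \<longleftrightarrow> \<not> (\<exists>Y \<in> fset A. Y \<le>\<^sub>g X)" if "X |\<in>| B" for X
  proof -
    have "\<not> left_threat b A \<le>\<^sub>g X'" if "X' |\<in>| options_left X" for X'
      using not_left_threat_le birthday_option_left[OF that] assms[OF \<open>X |\<in>| B\<close>] by auto
    then show ?thesis by (subst game_le.simps) (auto simp: left_threat_def)
  qed
  moreover have "\<not> left_threat b B \<le>\<^sub>g integer b"
    by (simp add: not_left_threat_le birthday_integer)
  ultimately show ?thesis
    by (subst game_le.simps) (auto simp: left_threat_def)
qed

lemma negate_double_threat: "negate (double_threat b L R) = double_threat b R L"
  by (auto simp: double_threat_def fimage_fimage)

text \<open>Right's options in \<open>A\<close> do not interfere, because Right's threat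
  \<open>-b\<close> lies below all of them, and Left's move to b is not above the threat
  \<open>{b | A}\<close>. Hence \<open>{b | A}\<close> serves as a probe for the options in
  \<open>L\<close>.\<close>

lemma double_threat_le_left_threat_iff:
  assumes "\<And>X. X |\<in>| A \<Longrightarrow> birthday X \<le> b"
  shows "double_threat b L R \<le>\<^sub>g left_threat b A \<longleftrightarrow> \<not> (\<exists>Y \<in> fset L. left_threat b A \<le>\<^sub>g Y)"
proof -
  have "\<not> X \<le>\<^sub>g double_threat b L R" if "X |\<in>| A" for X
    using negate_integer_le[OF assms[OF that]]
    by (subst game_le.simps) (auto simp: double_threat_def)
  moreover have "\<not> left_threat b A \<le>\<^sub>g integer b"
    by (simp add: not_left_threat_le birthday_integer)
  ultimately show ?thesis
    by (subst game_le.simps) (auto simp: left_threat_def double_threat_def)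
qed

lemma double_threat_le_imp:
  assumes "double_threat b L R \<le>\<^sub>g double_threat b L' R'"
    and "left_threat b A |\<in>| L" "\<And>X. X |\<in>| A \<Longrightarrow> birthday X \<le> b"
  shows "\<exists>Y \<in> fset L'. left_threat b A \<le>\<^sub>g Y"
proof (rule ccontr)
  assume "\<not> ?thesis"
  then have "double_threat b L' R' \<le>\<^sub>g left_threat b A"
    using double_threat_le_left_threat_iff assms(3) by blast
  then have "double_threat b L R \<le>\<^sub>g left_threat b A"
    using assms(1) game_le_trans by blast
  then show False
    using double_threat_le_left_threat_iff[OF assms(3), where L = L and R = R] assms(2) by auto
qed

text \<open>From \<open>X\<close> in \<open>A\<close> descend to some \<open>Y\<close> in
  \<open>B\<close> and then to some \<open>X'\<close> in \<open>A\<close>. The antichain property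
  forces \<open>X' = X\<close>, so \<open>X\<close> and \<open>Y\<close> are equal in value and, by
  \<open>canonical\<close>, identical.\<close>

lemma antichain_subset:
  assumes "\<And>X. X |\<in>| B \<Longrightarrow> birthday X \<le> b" "\<And>X. X |\<in>| A \<Longrightarrow> birthday X \<le> b"
    and "left_threat b A \<le>\<^sub>g left_threat b B" "left_threat b B \<le>\<^sub>g left_threat b A"
    and antichain: "\<And>X Y. X |\<in>| A \<Longrightarrow> Y |\<in>| A \<Longrightarrow> X \<le>\<^sub>g Y \<Longrightarrow> X = Y"
    and canonical: "\<And>X Y. X |\<in>| A \<Longrightarrow> Y |\<in>| B \<Longrightarrow> X \<le>\<^sub>g Y \<Longrightarrow> Y \<le>\<^sub>g X \<Longrightarrow> X = Y"
  shows "A |\<subseteq>| B"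
proof
  fix X assume X: "X |\<in>| A"
  obtain Y where Y: "Y |\<in>| B" "Y \<le>\<^sub>g X"
    using left_threat_le_iff[of A b B] assms(2,4) X by blast
  obtain X' where X': "X' |\<in>| A" "X' \<le>\<^sub>g Y"
    using left_threat_le_iff[of B b A] assms(1,3) Y by blast
  have "X' = X" using antichain X X' Y game_le_trans by blast
  with X' Y canonical show "X |\<in>| B" by metis
qed

text \<open>The second option on either side is chosen independently, as a threat
  \<open>{b | A}\<close> or as nothing. This yields one more choice than there are antichains, and
  the choices on both sides can be read off the value.\<close>

lemma num_born_by_ge_square:
  assumes fin: "finite \<A>"
    and bd: "\<And>A X. A \<in> \<A> \<Longrightarrow> X |\<in>| A \<Longrightarrow> birthday X \<le> b"
    and antichain: "\<And>A X Y. A \<in> \<A> \<Longrightarrow> X |\<in>| A \<Longrightarrow> Y |\<in>| A \<Longrightarrow> X \<le>\<^sub>g Y \<Longrightarrow> X = Y"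
    and canonical: "\<And>A B X Y. A \<in> \<A> \<Longrightarrow> B \<in> \<A> \<Longrightarrow> X |\<in>| A \<Longrightarrow> Y |\<in>| B \<Longrightarrow>
      X \<le>\<^sub>g Y \<Longrightarrow> Y \<le>\<^sub>g X \<Longrightarrow> X = Y"
  shows "(card \<A> + 1)\<^sup>2 \<le> num_born_by (b + 2)"
proof -
  define opt where "opt a = (case a of None \<Rightarrow> {||} | Some A \<Rightarrow> {|left_threat b A|})" for a
  define I where "I = insert None (Some ` \<A>)"
  have threat_eq: "A = B" if "A \<in> \<A>" "B \<in> \<A>"
      "left_threat b A \<le>\<^sub>g left_threat b B" "left_threat b B \<le>\<^sub>g left_threat b A" for A B
  proof -
    have "A |\<subseteq>| B"
      using that by (intro antichain_subset[where b = b]) (use bd antichain canonical in blast)+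
    moreover have "B |\<subseteq>| A"
      using that by (intro antichain_subset[where b = b]) (use bd antichain canonical in blast)+
    ultimately show ?thesis by blast
  qed
  \<comment> \<open>A present option has to be dominated by one of the other game. So
    \<open>None\<close> is told apart from every \<open>Some A\<close>, and two present options
    dominate each other.\<close>
  have threat: "\<exists>B. t = Some B \<and> left_threat b A \<le>\<^sub>g left_threat b B"
    if "s \<in> I" "t \<in> I" "s = Some A"
      "double_threat b (opt s) R \<le>\<^sub>g double_threat b (opt t) R'" for s t R R' A
    using double_threat_le_imp[OF that(4), of A] that(1-3) bd
    by (auto simp: opt_def I_def split: option.splits)
  have sub: "s = t" if "s \<in> I" "t \<in> I"
      "double_threat b (opt s) R \<le>\<^sub>g double_threat b (opt t) R'"
      "double_threat b (opt t) R' \<le>\<^sub>g double_threat b (opt s) R" for s t R R'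
    using threat[OF that(1,2) _ that(3)] threat[OF that(2,1) _ that(4)] threat_eq that(1,2)
    unfolding I_def by (cases s; cases t) auto
  have inj: "inj_on (\<lambda>(s, t). value_of (double_threat b (opt s) (opt t))) (I \<times> I)"
  proof (rule inj_onI, clarify)
    fix s t s' t'
    assume I: "s \<in> I" "t \<in> I" "s' \<in> I" "t' \<in> I"
      and "value_of (double_threat b (opt s) (opt t)) = value_of (double_threat b (opt s') (opt t'))"
    then have le: "double_threat b (opt s) (opt t) \<le>\<^sub>g double_threat b (opt s') (opt t')"
        "double_threat b (opt s') (opt t') \<le>\<^sub>g double_threat b (opt s) (opt t)"
      by (simp_all add: value_of_eq_iff)
    \<comment> \<open>Negation turns the right-hand options into left-hand ones, so
      \<open>sub\<close> also gives the second component.\<close>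
    from le have "double_threat b (opt t) (opt s) \<le>\<^sub>g double_threat b (opt t') (opt s')"
        "double_threat b (opt t') (opt s') \<le>\<^sub>g double_threat b (opt t) (opt s)"
      by (metis game_le_negate negate_double_threat)+
    with le sub I show "s = s' \<and> t = t'" by blast
  qed
  have "birthday X \<le> Suc b" if "s \<in> I" "X |\<in>| opt s" for s X
    using that bd by (auto simp: I_def opt_def split: option.splits intro!: birthday_left_threat)
  then have "birthday (double_threat b (opt s) (opt t)) \<le> b + 2" if "s \<in> I" "t \<in> I" for s t
    using birthday_double_threat[of "opt s" b "opt t"] that by simp
  then have "(\<lambda>(s, t). value_of (double_threat b (opt s) (opt t))) ` (I \<times> I) \<subseteq> born_by (b + 2)"
    by (auto simp: born_by_def)
  from card_mono[OF finite_born_by this] have "card (I \<times> I) \<le> num_born_by (b + 2)"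
    by (simp add: card_image[OF inj] num_born_by_def)
  moreover have "card I = card \<A> + 1"
    using fin by (simp add: I_def card_image)
  ultimately show ?thesis by (simp add: card_cartesian_product power2_eq_square)
qed

section \<open>Small days, and families of antichains\<close>

lemma num_born_by_0: "num_born_by 0 = 1"
  by (simp add: num_born_by_def born_by_def birthday_eq_0_iff)

lemma num_born_by_mono: "a \<le> b \<Longrightarrow> num_born_by a \<le> num_born_by b"
  unfolding num_born_by_def by (rule card_mono[OF finite_born_by]) (auto simp: born_by_def)

abbreviation star :: game where "star \<equiv> Game {|integer 0|} {|integer 0|}"

lemma birthday_star: "birthday star \<le> Suc b"
proof -
  have "birthday Y \<le> b" if "Y |\<in>| options p star" for p Y
    using that birthday_eq_0_iff[of Y] by (cases p) auto
  then show ?thesis by (auto simp: birthday_le_Suc_iff)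
qed

lemma zero_star_incomparable: "\<not> integer 0 \<le>\<^sub>g star" "\<not> star \<le>\<^sub>g integer 0"
  using not_game_le_right[of "integer 0" star] not_game_le_left[of "integer 0" star] by simp_all

lemma num_born_by_Suc_0_ge: "4 \<le> num_born_by (Suc 0)"
proof -
  let ?z = "integer 0" let ?o = "integer (Suc 0)" let ?m = "negate (integer (Suc 0))"
  have "\<not> star \<le>\<^sub>g ?z" "\<not> ?z \<le>\<^sub>g star" by (fact zero_star_incomparable)+
  moreover have "\<not> ?o \<le>\<^sub>g ?z" by (rule not_game_le_left[of ?z ?o]) simp
  moreover have "\<not> ?z \<le>\<^sub>g ?m" by (rule not_game_le_right[of ?z ?m]) simp
  moreover have "?m \<le>\<^sub>g ?z"
    using negate_integer_le[of ?z "Suc 0"] birthday_integer[of 0] by simp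
  moreover have "?z \<le>\<^sub>g ?o"
    using game_le_integer[of ?z "Suc 0"] birthday_integer[of 0] by simp
  ultimately have "value_of ?z \<noteq> value_of ?o" "value_of ?z \<noteq> value_of ?m"
      "value_of ?z \<noteq> value_of star" "value_of ?o \<noteq> value_of ?m"
      "value_of ?o \<noteq> value_of star" "value_of ?m \<noteq> value_of star"
    unfolding value_of_eq_iff by (meson game_le_trans)+
  then have "card (value_of ` {?z, ?o, ?m, star}) = 4"
    by (simp del: integer.simps negate.simps)
  moreover have "value_of ` {?z, ?o, ?m, star} \<subseteq> born_by (Suc 0)"
    using birthday_star[of 0] birthday_integer[of 0] birthday_integer[of "Suc 0"]
    unfolding born_by_def by (auto simp del: integer.simps negate.simps)
  ultimately show ?thesis
    unfolding num_born_by_def by (metis card_mono finite_born_by)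
qed

text \<open>The antichain argument identifies games literally, while the order sees only values;
  hence one fixed game is chosen for each value.\<close>

definition representative :: "nat \<Rightarrow> game_value \<Rightarrow> game" where
  "representative b x = (SOME X. birthday X \<le> b \<and> value_of X = x)"

lemma representative:
  assumes "x \<in> born_by b"
  shows "birthday (representative b x) \<le> b" "value_of (representative b x) = x"
  using someI_ex[of "\<lambda>X. birthday X \<le> b \<and> value_of X = x"] assms
  by (auto simp: representative_def born_by_def)

lemma representative_eq_iff:
  "x \<in> born_by b \<Longrightarrow> y \<in> born_by b \<Longrightarrow>
    representative b x \<le>\<^sub>g representative b y \<Longrightarrow> representative b y \<le>\<^sub>g representative b x \<Longrightarrow> x = y"
  by (metis representative(2) value_of_eq_iff)

lemma card_singletons:
  "card (insert {||} ((\<lambda>x. {|representative b x|}) ` born_by b)) = num_born_by b + 1"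
proof -
  have "inj_on (\<lambda>x. {|representative b x|}) (born_by b)"
    by (rule inj_onI) (metis representative(2) fsingleton_inject)
  moreover have "{||} \<notin> (\<lambda>x. {|representative b x|}) ` born_by b" by auto
  ultimately show ?thesis by (simp add: card_image num_born_by_def)
qed

lemma num_born_by_ge_square_2: "(num_born_by b + 2)\<^sup>2 \<le> num_born_by (b + 2)"
proof -
  let ?A = "insert {||} ((\<lambda>x. {|representative b x|}) ` born_by b)"
  have "(card ?A + 1)\<^sup>2 \<le> num_born_by (b + 2)"
    by (rule num_born_by_ge_square) (auto simp: representative dest: representative_eq_iff)
  then show ?thesis unfolding card_singletons by simp
qed

text \<open>For b at least 1 both 0 and \<open>*\<close> are available. They are incomparable, so
  together they form an antichain besides the empty set and the singletons.\<close>

lemma num_born_by_ge_square_3: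
  assumes "1 \<le> b"
  shows "(num_born_by b + 3)\<^sup>2 \<le> num_born_by (b + 2)"
proof -
  let ?S = "insert {||} ((\<lambda>x. {|representative b x|}) ` born_by b)"
  define z where "z = value_of (integer 0)"
  define s where "s = value_of star"
  obtain b' where b': "b = Suc b'" using assms by (cases b) auto
  have born: "z \<in> born_by b" "s \<in> born_by b"
    using birthday_star[of b'] birthday_integer[of 0] unfolding b' born_by_def z_def s_def by auto
  have le: "representative b z \<le>\<^sub>g integer 0" "integer 0 \<le>\<^sub>g representative b z"
      "representative b s \<le>\<^sub>g star" "star \<le>\<^sub>g representative b s"
    using representative(2)[OF born(1)] representative(2)[OF born(2)]
    unfolding z_def s_def value_of_eq_iff by blast+
  have inc: "\<not> representative b z \<le>\<^sub>g representative b s"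
      "\<not> representative b s \<le>\<^sub>g representative b z"
    using le zero_star_incomparable by (meson game_le_trans)+
  let ?P = "{|representative b z, representative b s|}"
  have "?P \<notin> ?S"
    using inc by (auto simp: fset_eq_iff)
  then have "card (insert ?P ?S) = num_born_by b + 2"
    using card_singletons[of b] by simp
  moreover have "(card (insert ?P ?S) + 1)\<^sup>2 \<le> num_born_by (b + 2)"
    by (rule num_born_by_ge_square)
      (use born inc in \<open>auto simp: representative dest: representative_eq_iff\<close>)
  ultimately show ?thesis by (simp add: numeral_3_eq_3)
qed

section \<open>Placement positions\<close>

primrec colour_of :: "player \<Rightarrow> colour" where
  "colour_of Left = Blue"
| "colour_of Right = Red"

lemma colour_of_eq_iff [simp]: "colour_of p = colour_of q \<longleftrightarrow> p = q"
  by (cases p; cases q) auto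

definition residual :: "'a pair_pre_digraph \<Rightarrow> 'a fset \<Rightarrow> 'a \<Rightarrow> 'a fset" where
  "residual G S v = ffilter (\<lambda>w. w \<noteq> v \<and> (v, w) \<notin> parcs G) S"

lemma options_placement_position:
  "options p (placement_position G c S) =
     (\<lambda>v. placement_position G c (residual G S v)) |`| ffilter (\<lambda>v. c v = colour_of p) S"
  by (subst placement_position.simps) (cases p; simp add: residual_def)

text \<open>An isomorphism of the remaining induced digraphs carries every move along, so the games
  agree as trees and not just in value. Loops may differ, as a played vertex disappears
  anyway.\<close>

lemma placement_position_transport:
  assumes "inj_on h (fset S)"
    and "\<And>u. u |\<in>| S \<Longrightarrow> c' (h u) = c u"
    and "\<And>u v. u |\<in>| S \<Longrightarrow> v |\<in>| S \<Longrightarrow> u \<noteq> v \<Longrightarrow> (h u, h v) \<in> parcs G' \<longleftrightarrow> (u, v) \<in> parcs G"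
  shows "placement_position G' c' (h |`| S) = placement_position G c S"
  using assms
proof (induction "fcard S" arbitrary: S rule: less_induct)
  case less
  have res: "placement_position G' c' (residual G' (h |`| S) (h v))
      = placement_position G c (residual G S v)" if v: "v |\<in>| S" for v
  proof -
    have "residual G' (h |`| S) (h v) = h |`| residual G S v"
      using less.prems(3)[OF v] inj_onD[OF less.prems(1)] v
      by (intro fset_eqI) (auto simp: residual_def)
    moreover have "residual G S v |\<subset>| S"
      using v by (auto simp: residual_def)
    then have "fcard (residual G S v) < fcard S" by (rule pfsubset_fcard_mono)
    moreover have sub: "w |\<in>| S" if "w |\<in>| residual G S v" for w
      using that by (auto simp: residual_def)
    ultimately show ?thesis
      using less.hyps[of "residual G S v"] less.prems inj_on_subset[OF less.prems(1)]
      by (simp add: subset_iff)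
  qed
  have "options p (placement_position G' c' (h |`| S)) = options p (placement_position G c S)" for p
    unfolding options_placement_position using res less.prems(2)
    by (intro fset_eqI) (force simp: image_iff)
  from this[of Left] this[of Right] show ?case
    by (metis game.collapse options.simps)
qed

text \<open>Dropping loops and the arcs that leave \<open>S\<close> yields a proper digraph with the
  same game. The constructions below may therefore use arbitrary arc relations.\<close>

lemma is_placement_value_placement_position:
  "is_placement_value (fcard S) (value_of (placement_position G c (S :: nat fset)))"
proof -
  define G' where "G' = \<lparr>pverts = fset S,
    parcs = {(u, v). (u, v) \<in> parcs G \<and> u |\<in>| S \<and> v |\<in>| S \<and> u \<noteq> v}\<rparr>"
  have "parcs G' \<subseteq> fset S \<times> fset S" by (auto simp: G'_def)
  then have "finite (parcs G')" by (rule finite_subset) simp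
  then have "pair_digraph G'"
    by unfold_locales (auto simp: G'_def)
  moreover have "placement_position G' c (id |`| S) = placement_position G c S"
    by (rule placement_position_transport) (auto simp: G'_def)
  ultimately show ?thesis
    unfolding is_placement_value_def
    by (intro exI[of _ G'] exI[of _ c] exI[of _ S]) (auto simp: G'_def fcard.rep_eq)
qed

section \<open>Comparison from either player's point of view, and gift horses\<close>

primrec at_most :: "player \<Rightarrow> game \<Rightarrow> game \<Rightarrow> bool" where
  "at_most Left X Y \<longleftrightarrow> X \<le>\<^sub>g Y"
| "at_most Right X Y \<longleftrightarrow> Y \<le>\<^sub>g X"

lemma at_most_iff:
  "at_most p X Y \<longleftrightarrow> (\<forall>X' \<in> fset (options p X). \<not> at_most p Y X') \<and>
    (\<forall>Y' \<in> fset (options (opponent p) Y). \<not> at_most p Y' X)"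
  using game_le.simps[of X Y] game_le.simps[of Y X] by (cases p) auto

lemma at_most_refl: "at_most p X X"
  by (cases p) auto

lemma at_most_cong:
  assumes "value_of X = value_of X'" "value_of Y = value_of Y'"
  shows "at_most p X Y \<longleftrightarrow> at_most p X' Y'"
  using assms unfolding value_of_eq_iff by (cases p) (auto intro: game_le_trans)

text \<open>The gift horse principle: if the opponent can answer an extra move of p by going to a
  position no better for p than \<open>X\<close>, then the position after that move is not at least
  as good for p as \<open>X\<close>, and having it as an option changes nothing.\<close>

lemma value_of_eq_gift_horse:
  assumes match: "\<And>p X'. X' |\<in>| options p X \<Longrightarrow> \<exists>P' \<in> fset (options p P). value_of P' = value_of X'"
    and gift: "\<And>p P'. P' |\<in>| options p P \<Longrightarrow>
      (\<exists>X' \<in> fset (options p X). value_of P' = value_of X') \<or>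
      (\<exists>P'' \<in> fset (options (opponent p) P'). at_most p P'' X)"
  shows "value_of P = value_of X"
proof -
  have "at_most p P X" for p
    unfolding at_most_iff[of p P X]
  proof (intro conjI ballI)
    fix P' assume "P' |\<in>| options p P"
    then consider X' where "X' |\<in>| options p X" "value_of P' = value_of X'"
      | P'' where "P'' |\<in>| options (opponent p) P'" "at_most p P'' X"
      using gift by blast
    then show "\<not> at_most p X P'"
    proof cases
      case 1
      then have "\<not> at_most p X X'" using at_most_iff[of p X X] at_most_refl by blast
      then show ?thesis using at_most_cong[of X X P' X' p] 1 by simp
    next
      case 2
      then show ?thesis using at_most_iff[of p X P'] by blast
    qed
  next
    fix X' assume "X' |\<in>| options (opponent p) X"
    then obtain P' where P': "P' |\<in>| options (opponent p) P" "value_of P' = value_of X'"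
      using match by blast
    then have "\<not> at_most p P' P" using at_most_iff[of p P P] at_most_refl by blast
    then show "\<not> at_most p X' P" using at_most_cong[of P' X' P P p] P' by simp
  qed
  from this[of Left] this[of Right] show ?thesis by (simp add: value_of_eq_iff)
qed

text \<open>Pairwise independent vertices of the opponent's colour are free moves for the opponent.
  With n of them the position is an integer or its negative, which is the worst for p among the
  games born by day n.\<close>

lemma at_most_monochromatic:
  assumes "\<And>v. v |\<in>| S \<Longrightarrow> c v = colour_of (opponent p)"
    and "\<And>u v. u |\<in>| S \<Longrightarrow> v |\<in>| S \<Longrightarrow> (u, v) \<notin> parcs G"
    and "birthday X \<le> fcard S"
  shows "at_most p (placement_position G c S) X"
  using assms
proof (induction "fcard S" arbitrary: S X)
  case 0
  then have "S = {||}" by simp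
  moreover have "X = Game {||} {||}"
    using 0 birthday_eq_0_iff by (metis le_zero_eq)
  ultimately show ?case
    by (subst at_most_iff) (cases p; simp add: options_placement_position)
next
  case (Suc n)
  show ?case unfolding at_most_iff[of p _ X]
  proof (intro conjI ballI)
    fix X' assume X': "X' |\<in>| options (opponent p) X"
    from Suc(2) obtain v where v: "v |\<in>| S" by (metis Zero_neq_Suc all_not_fin_conv fcard_fempty)
    have res: "residual G S v = S |-| {|v|}"
      using Suc.prems(2)[OF v] by (intro fset_eqI) (auto simp: residual_def)
    have "fcard (S |-| {|v|}) = n" using Suc(2) v by (simp add: fcard_fminus_fsingleton)
    moreover have "birthday X' \<le> n" using birthday_option[OF X'] Suc.prems(3) Suc(2) by simp
    ultimately have "at_most p (placement_position G c (residual G S v)) X'"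
      unfolding res using Suc.prems(1,2) by (intro Suc.hyps(1)) auto
    moreover have "placement_position G c (residual G S v)
        |\<in>| options (opponent p) (placement_position G c S)"
      using v Suc.prems(1)[OF v] by (auto simp: options_placement_position)
    ultimately show "\<not> at_most p X' (placement_position G c S)"
      using at_most_iff[of p X'] by blast
  qed (use Suc.prems(1) in \<open>auto simp: options_placement_position\<close>)
qed

section \<open>Universal digraphs\<close>

definition universal :: "'a pair_pre_digraph \<Rightarrow> ('a \<Rightarrow> colour) \<Rightarrow> 'a fset \<Rightarrow> nat \<Rightarrow> bool" where
  "universal G c V b \<longleftrightarrow>
     (\<forall>x \<in> born_by b. \<exists>S. S |\<subseteq>| V \<and> value_of (placement_position G c S) = x)"

text \<open>The extension step produces a digraph on the type \<open>vertex\<close>; relabelling by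
  naturals lets it be iterated and meets the vertex type in
  \<open>is_placement_value\<close>.\<close>

lemma universal_transport_nat:
  fixes V :: "'a fset"
  assumes "universal G c V b"
  obtains G' :: "nat pair_pre_digraph" and c' V' where "fcard V' = fcard V" "universal G' c' V' b"
proof -
  obtain h :: "'a \<Rightarrow> nat" where h: "inj_on h (fset V)"
    using finite_imp_inj_to_nat_seg[of "fset V"] by auto
  define G' where "G' = \<lparr>pverts = {},
    parcs = {(x, y). \<exists>u v. (u, v) \<in> parcs G \<and> u |\<in>| V \<and> v |\<in>| V \<and> h u = x \<and> h v = y}\<rparr>"
  define c' where "c' = c \<circ> inv_into (fset V) h"
  have "placement_position G' c' (h |`| S) = placement_position G c S" if "S |\<subseteq>| V" for S
  proof (rule placement_position_transport)
    show "inj_on h (fset S)" using h that inj_on_subset by (metis less_eq_fset.rep_eq)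
    show "c' (h u) = c u" if "u |\<in>| S" for u
      using \<open>S |\<subseteq>| V\<close> that h by (auto simp: c'_def)
    show "(h u, h v) \<in> parcs G' \<longleftrightarrow> (u, v) \<in> parcs G"
      if "u |\<in>| S" "v |\<in>| S" for u v
    proof -
      have V: "u |\<in>| V" "v |\<in>| V" using \<open>S |\<subseteq>| V\<close> that by auto
      have "u' = u" if "u' |\<in>| V" "h u' = h u" for u' using inj_onD[OF h] that V by blast
      moreover have "v' = v" if "v' |\<in>| V" "h v' = h v" for v' using inj_onD[OF h] that V by blast
      moreover have "(h u, h v) \<in> parcs G' \<longleftrightarrow> (\<exists>u' v'. (u', v') \<in> parcs G \<and>
          u' |\<in>| V \<and> v' |\<in>| V \<and> h u' = h u \<and> h v' = h v)"
        by (auto simp: G'_def)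
      ultimately show ?thesis using V by metis
    qed
  qed
  then have "universal G' c' (h |`| V) b"
    using assms unfolding universal_def by (metis fimage_mono)
  moreover have "fcard (h |`| V) = fcard V"
    using h by (simp add: fcard.rep_eq card_image)
  ultimately show ?thesis using that by blast
qed

lemma max_min_vertices_le:
  assumes "universal (G :: nat pair_pre_digraph) c V b"
  shows "max_min_vertices b \<le> fcard V"
proof -
  have "min_vertices x \<le> fcard V" if "x \<in> born_by b" for x
  proof -
    from assms that obtain S where S: "S |\<subseteq>| V" "value_of (placement_position G c S) = x"
      unfolding universal_def by blast
    then have "is_placement_value (fcard S) x"
      using is_placement_value_placement_position by metis
    then have "min_vertices x \<le> fcard S" unfolding min_vertices_def by (rule Least_le)
    also have "\<dots> \<le> fcard V" using S(1) by (rule fcard_mono)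
    finally show ?thesis .
  qed
  moreover have "value_of (integer 0) \<in> born_by b"
    unfolding born_by_def using birthday_integer[of 0] by (intro imageI) simp
  then have "born_by b \<noteq> {}" by blast
  ultimately show ?thesis
    unfolding max_min_vertices_def by (subst Max_le_iff) auto
qed

section \<open>The extension from one day to the next\<close>

datatype vertex = Old nat | Choice player game_value | Guard player bool nat

text \<open>The classes of guards form the cycle (Left, True), (Right, True), (Left, False),
  (Right, False), in which \<open>reply p i\<close> belongs to the successor of \<open>(p, i)\<close>. A guard spares its own
  class and the next one. Hence a guard of the next class, played in reply, deletes the rest of
  the class of the first guard, and only its own class survives both moves.\<close>

fun reply :: "player \<Rightarrow> bool \<Rightarrow> bool" where
  "reply Left i = i"
| "reply Right i = (\<not> i)"

lemma reply_reply [simp]: "reply (opponent p) (reply p i) \<longleftrightarrow> \<not> i"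
  by (cases p) auto

text \<open>A choice for the value x leaves exactly the copy \<open>S x\<close> among the old
  vertices. An old vertex removes the guards of its own colour and spares those of the other colour,
  with which the opponent replies.\<close>

fun deletes :: "(nat \<times> nat) set \<Rightarrow> (nat \<Rightarrow> colour) \<Rightarrow> (game_value \<Rightarrow> nat fset) \<Rightarrow>
    vertex \<Rightarrow> vertex \<Rightarrow> bool" where
  "deletes E c S (Old u) (Old w) \<longleftrightarrow> (u, w) \<in> E"
| "deletes E c S (Old u) (Choice q y) \<longleftrightarrow> False"
| "deletes E c S (Old u) (Guard q i j) \<longleftrightarrow> c u = colour_of q"
| "deletes E c S (Choice p x) (Old w) \<longleftrightarrow> w |\<notin>| S x"
| "deletes E c S (Choice p x) (Choice q y) \<longleftrightarrow> True"
| "deletes E c S (Choice p x) (Guard q i j) \<longleftrightarrow> True"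
| "deletes E c S (Guard p i j) (Old w) \<longleftrightarrow> True"
| "deletes E c S (Guard p i j) (Choice q y) \<longleftrightarrow> True"
| "deletes E c S (Guard p i j) (Guard q i' j') \<longleftrightarrow>
     (q, i') \<noteq> (p, i) \<and> (q, i') \<noteq> (opponent p, reply p i)"

primrec vertex_colour :: "(nat \<Rightarrow> colour) \<Rightarrow> vertex \<Rightarrow> colour" where
  "vertex_colour c (Old u) = c u"
| "vertex_colour c (Choice p x) = colour_of p"
| "vertex_colour c (Guard p i j) = colour_of p"

lemma UNIV_player: "UNIV = {Left, Right}"
  by (auto intro: player.exhaust)

lemma finite_UNIV_player [simp]: "finite (UNIV :: player set)"
  by (simp add: UNIV_player)

lemma card_UNIV_player [simp]: "card (UNIV :: player set) = 2"
  by (simp add: UNIV_player)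

definition guards :: "nat \<Rightarrow> vertex fset" where
  "guards k = (\<lambda>(p, i, j). Guard p i j) |`| Abs_fset (UNIV \<times> UNIV \<times> {..<k})"

lemma in_guards_iff [simp]: "v |\<in>| guards k \<longleftrightarrow> (\<exists>p i j. v = Guard p i j \<and> j < k)"
  by (auto simp: guards_def Abs_fset_inverse image_iff)

lemma fcard_guards: "fcard (guards k) \<le> 4 * k"
proof -
  have "card (UNIV \<times> UNIV \<times> {..<k} :: (player \<times> bool \<times> nat) set) = 4 * k"
    by (simp add: card_cartesian_product)
  moreover have "fcard (guards k) \<le> card (UNIV \<times> UNIV \<times> {..<k} :: (player \<times> bool \<times> nat) set)"
    unfolding guards_def fcard.rep_eq fimage.rep_eq
    by (subst Abs_fset_inverse, simp, rule card_image_le, simp)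
  ultimately show ?thesis by simp
qed

text \<open>\<open>k\<close> is the size of each class of guards. After the reply
  \<open>k - 1\<close> guards remain, which must be at least the birthday b + 1, whence b + 2. If
  \<open>V\<close> and the guards are empty, every first move is a choice and no reply is called
  for.\<close>

locale extension =
  fixes G :: "nat pair_pre_digraph" and c :: "nat \<Rightarrow> colour" and V :: "nat fset"
    and b k :: nat and S :: "game_value \<Rightarrow> nat fset"
  assumes S: "x \<in> born_by b \<Longrightarrow> S x |\<subseteq>| V"
      "x \<in> born_by b \<Longrightarrow> value_of (placement_position G c (S x)) = x"
    and guarded: "V = {||} \<and> k = 0 \<or> b + 2 \<le> k"
begin

definition H :: "vertex pair_pre_digraph" where
  "H = \<lparr>pverts = {}, parcs = {(u, v). deletes (parcs G) c S u v}\<rparr>"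

definition host :: "game \<Rightarrow> vertex fset" where
  "host X = Old |`| V |\<union>| (Choice Left \<circ> value_of) |`| options Left X |\<union>|
    (Choice Right \<circ> value_of) |`| options Right X |\<union>| guards k"

lemma in_host_iff [simp]:
  "Old u |\<in>| host X \<longleftrightarrow> u |\<in>| V"
  "Choice p x |\<in>| host X \<longleftrightarrow> x |\<in>| value_of |`| options p X"
  "Guard p i j |\<in>| host X \<longleftrightarrow> j < k"
  by (cases p; auto simp: host_def)+

abbreviation pos :: "vertex fset \<Rightarrow> game" where
  "pos \<equiv> placement_position H (vertex_colour c)"

lemma in_residual_iff [simp]:
  "w |\<in>| residual H T v \<longleftrightarrow> w |\<in>| T \<and> w \<noteq> v \<and> \<not> deletes (parcs G) c S v w"
  by (auto simp: residual_def H_def)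

lemma born_by_option:
  "birthday X \<le> Suc b \<Longrightarrow> X' |\<in>| options p X \<Longrightarrow> value_of X' \<in> born_by b"
  unfolding birthday_le_Suc_iff born_by_def by blast

lemma value_of_pos_Choice:
  assumes "x \<in> born_by b"
  shows "value_of (pos (residual H (host X) (Choice p x))) = x"
proof -
  have "residual H (host X) (Choice p x) = Old |`| S x"
  proof (rule fset_eqI)
    fix v show "v |\<in>| residual H (host X) (Choice p x) \<longleftrightarrow> v |\<in>| Old |`| S x"
      using S(1)[OF assms] by (cases v) auto
  qed
  moreover have "pos (Old |`| S x) = placement_position G c (S x)"
    by (rule placement_position_transport) (auto simp: H_def inj_on_def)
  ultimately show ?thesis using S(2)[OF assms] by simp
qed

text \<open>These are the guards of one class that remain once the one with index 0 has been played
  as the reply.\<close>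

lemma at_most_guards:
  assumes "birthday X < k"
  shows "at_most p (pos (Guard (opponent p) i |`| Abs_fset {1..<k})) X"
proof (rule at_most_monochromatic)
  have "fcard (Guard (opponent p) i |`| Abs_fset {1..<k}) = k - 1"
    by (simp add: fcard.rep_eq Abs_fset_inverse card_image inj_on_def)
  then show "birthday X \<le> fcard (Guard (opponent p) i |`| Abs_fset {1..<k})"
    using assms by simp
qed (auto simp: H_def)

lemma reply_to_bad_move:
  assumes X: "birthday X \<le> Suc b"
    and v: "v |\<in>| host X" "vertex_colour c v = colour_of p" "\<nexists>q x. v = Choice q x"
  shows "\<exists>P \<in> fset (options (opponent p) (pos (residual H (host X) v))). at_most p P X"
proof -
  have k: "b + 2 \<le> k"
    using v guarded by (cases v) auto
  \<comment> \<open>After an old vertex either class of the opponent's colour would do, and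
    \<open>True\<close> is an arbitrary pick; after a guard it has to be the next class of the
    cycle.\<close>
  define i where "i = (case v of Guard q i j \<Rightarrow> reply p i | _ \<Rightarrow> True)"
  let ?w = "Guard (opponent p) i 0"
  have w: "?w |\<in>| residual H (host X) v"
    using v k by (cases v) (auto simp: i_def)
  have "residual H (residual H (host X) v) ?w = Guard (opponent p) i |`| Abs_fset {1..<k}"
  proof (rule fset_eqI)
    fix u
    show "u |\<in>| residual H (residual H (host X) v) ?w \<longleftrightarrow>
        u |\<in>| Guard (opponent p) i |`| Abs_fset {1..<k}"
      using v k by (cases u; cases v) (auto simp: i_def Abs_fset_inverse)
  qed
  moreover have "pos (residual H (residual H (host X) v) ?w)
      |\<in>| options (opponent p) (pos (residual H (host X) v))"
    using w by (auto simp: options_placement_position)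
  ultimately show ?thesis
    using at_most_guards[of X p i] X k by auto
qed

lemma value_of_pos_host:
  assumes X: "birthday X \<le> Suc b"
  shows "value_of (pos (host X)) = value_of X"
proof (rule value_of_eq_gift_horse)
  fix p X' assume X': "X' |\<in>| options p X"
  then have "pos (residual H (host X) (Choice p (value_of X'))) |\<in>| options p (pos (host X))"
    by (auto simp: options_placement_position)
  then show "\<exists>P' \<in> fset (options p (pos (host X))). value_of P' = value_of X'"
    using value_of_pos_Choice born_by_option[OF X X'] by blast
next
  fix p P' assume "P' |\<in>| options p (pos (host X))"
  then obtain v where v: "v |\<in>| host X" "vertex_colour c v = colour_of p"
      and P': "P' = pos (residual H (host X) v)"
    by (auto simp: options_placement_position)
  show "(\<exists>X' \<in> fset (options p X). value_of P' = value_of X') \<or>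
      (\<exists>P'' \<in> fset (options (opponent p) P'). at_most p P'' X)"
  proof (cases "\<exists>q x. v = Choice q x")
    case True
    with v obtain X' where "v = Choice p (value_of X')" "X' |\<in>| options p X" by auto
    then show ?thesis
      using value_of_pos_Choice born_by_option[OF X] P' by blast
  next
    case False
    then show ?thesis using reply_to_bad_move[OF X v] P' by blast
  qed
qed

definition host_vertices :: "vertex fset" where
  "host_vertices = Old |`| V |\<union>| Choice Left |`| Abs_fset (born_by b) |\<union>|
    Choice Right |`| Abs_fset (born_by b) |\<union>| guards k"

lemma fcard_host_vertices: "fcard host_vertices \<le> fcard V + 2 * num_born_by b + 4 * k"
proof -
  have born: "fcard (Choice p |`| Abs_fset (born_by b)) = num_born_by b" for p
    by (simp add: fcard.rep_eq Abs_fset_inverse num_born_by_def card_image inj_on_def)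
  have "fcard (Old |`| V) = fcard V"
    by (simp add: fcard.rep_eq card_image inj_on_def)
  moreover have "fcard (A |\<union>| B) \<le> fcard A + fcard B" for A B :: "vertex fset"
    by (simp add: fcard.rep_eq card_Un_le)
  ultimately show ?thesis
    unfolding host_vertices_def using born[of Left] born[of Right] fcard_guards[of k]
    by (smt (verit) add_mono order_trans mult_2 add.assoc order_refl)
qed

lemma universal_host_vertices: "universal H (vertex_colour c) host_vertices (Suc b)"
  unfolding universal_def
proof
  fix x assume "x \<in> born_by (Suc b)"
  then obtain X where X: "birthday X \<le> Suc b" "value_of X = x" by (auto simp: born_by_def)
  have "host X |\<subseteq>| host_vertices"
    using born_by_option[OF X(1), of _ Left] born_by_option[OF X(1), of _ Right]
    by (auto simp: host_def host_vertices_def Abs_fset_inverse)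
  with X value_of_pos_host show "\<exists>T. T |\<subseteq>| host_vertices \<and> value_of (pos T) = x" by blast
qed

end

section \<open>Iterating the extension, and numerical estimates\<close>

definition has_universal :: "nat \<Rightarrow> nat \<Rightarrow> bool" where
  "has_universal b m \<longleftrightarrow> (\<exists>(G :: nat pair_pre_digraph) c V. fcard V \<le> m \<and> universal G c V b)"

lemma has_universal_Suc:
  assumes "has_universal b m" and k: "m = 0 \<and> k = 0 \<or> b + 2 \<le> k"
  shows "has_universal (Suc b) (m + 2 * num_born_by b + 4 * k)"
proof -
  from assms obtain G :: "nat pair_pre_digraph" and c V
    where V: "fcard V \<le> m" "universal G c V b" unfolding has_universal_def by blast
  then obtain S where "\<And>x. x \<in> born_by b \<Longrightarrow>
      S x |\<subseteq>| V \<and> value_of (placement_position G c (S x)) = x"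
    unfolding universal_def by metis
  then interpret extension G c V b k S
    using V(1) k by unfold_locales auto
  obtain G' :: "nat pair_pre_digraph" and c' V' where "fcard V' = fcard host_vertices"
      "universal G' c' V' (Suc b)"
    using universal_transport_nat[OF universal_host_vertices] by blast
  moreover have "fcard host_vertices \<le> m + 2 * num_born_by b + 4 * k"
    using fcard_host_vertices V(1) by linarith
  ultimately show ?thesis unfolding has_universal_def by metis
qed

lemma has_universal_0: "has_universal 0 0"
proof -
  have "placement_position (G :: nat pair_pre_digraph) c {||} = Game {||} {||}" for G c
    by (subst placement_position.simps) (auto simp: fset_eq_iff)
  then show ?thesis
    unfolding has_universal_def universal_def born_by_def
    by (auto simp: birthday_eq_0_iff intro!: exI[of _ "{||}"])
qed

lemma num_born_by_ge: "b \<le> num_born_by b"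
proof (induction b rule: nat_less_induct)
  case (1 b)
  have "b = 0 \<or> b = 1 \<or> (\<exists>a. b = a + 2)" by presburger
  then consider "b = 0" | "b = 1" | a where "b = a + 2" by blast
  then show ?case
  proof cases
    case 3
    then have "a \<le> num_born_by a" using 1 by simp
    moreover have "(num_born_by a + 2)\<^sup>2 \<le> num_born_by b"
      using num_born_by_ge_square_2 3 by simp
    ultimately show ?thesis using 3 by (simp add: power2_eq_square)
  qed (use num_born_by_Suc_0_ge in auto)
qed

lemma num_born_by_ge_49: "3 \<le> b \<Longrightarrow> 49 \<le> num_born_by b"
proof -
  assume "3 \<le> b"
  have "(7::nat)\<^sup>2 \<le> (num_born_by 1 + 3)\<^sup>2"
    using num_born_by_Suc_0_ge by (intro power_mono) auto
  also have "\<dots> \<le> num_born_by 3"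
    using num_born_by_ge_square_3[of 1] by (simp add: numeral_3_eq_3)
  also have "\<dots> \<le> num_born_by b"
    using \<open>3 \<le> b\<close> by (rule num_born_by_mono)
  finally show ?thesis by simp
qed

lemma num_born_by_2_ge: "9 \<le> num_born_by 2"
  using num_born_by_ge_square_2[of 0] by (simp add: num_born_by_0 numeral_2_eq_2)

lemma has_universal_1: "has_universal 1 2"
  using has_universal_Suc[OF has_universal_0, of 0] by (simp add: num_born_by_0 numeral_2_eq_2)

lemma has_universal_2: "has_universal 2 (14 + 2 * num_born_by 1)"
proof -
  have "has_universal (Suc 1) (2 + 2 * num_born_by 1 + 4 * 3)"
    \<comment> \<open>Day 1 calls for classes of 1 + 2 = 3 guards.\<close>
    by (rule has_universal_Suc[OF has_universal_1]) simp
  moreover have "2 + 2 * num_born_by 1 + 4 * 3 = 14 + 2 * num_born_by 1" by simp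
  ultimately show ?thesis by (metis Suc_1)
qed

lemma has_universal_3: "has_universal 3 (30 + 2 * num_born_by 1 + 2 * num_born_by 2)"
proof -
  have "has_universal (Suc 2) (14 + 2 * num_born_by 1 + 2 * num_born_by 2 + 4 * 4)"
    by (rule has_universal_Suc[OF has_universal_2]) simp
  moreover have "14 + 2 * num_born_by 1 + 2 * num_born_by 2 + 4 * 4 =
      30 + 2 * num_born_by 1 + 2 * num_born_by 2" by simp
  moreover have "Suc 2 = 3" by simp
  ultimately show ?thesis by metis
qed

text \<open>The induction goes in steps of two because the quadratic growth relates the days a and a
  + 2. The summand b + 1 is included so that the bound also absorbs the term -b of the
  theorem.\<close>

lemma has_universal_linear:
  "1 \<le> b \<Longrightarrow> \<exists>m. has_universal (b + 1) m \<and> m + b + 1 \<le> 8 * num_born_by b"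
proof (induction b rule: nat_less_induct)
  case (1 b)
  note IH = 1(1)
  have "b = 1 \<or> b = 2 \<or> (\<exists>a. b = a + 2 \<and> 1 \<le> a)" using \<open>1 \<le> b\<close> by presburger
  then consider "b = 1" | "b = 2" | a where "b = a + 2" "1 \<le> a" by blast
  then show ?case
  proof cases
    case 1
    have "has_universal (b + 1) (14 + 2 * num_born_by 1)"
      using has_universal_2 unfolding 1 one_add_one .
    moreover have "14 + 2 * num_born_by 1 + b + 1 \<le> 8 * num_born_by b"
      using 1 num_born_by_Suc_0_ge by simp
    ultimately show ?thesis by blast
  next
    case 2
    then show ?thesis using has_universal_3 num_born_by_2_ge num_born_by_mono[of 1 2]
      by (intro exI[of _ "30 + 2 * num_born_by 1 + 2 * num_born_by 2"]) auto
  next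
    case 3
    then have "a < b" by simp
    with IH 3 obtain m where m: "has_universal (a + 1) m" "m + a + 1 \<le> 8 * num_born_by a"
      by blast
    define m' where "m' = m + 2 * num_born_by (a + 1) + 4 * (a + 3) +
      2 * num_born_by (a + 2) + 4 * (a + 4)"
    have "has_universal (b + 1) m'"
      using has_universal_Suc[OF has_universal_Suc[OF m(1), of "a + 3"], of "a + 4"] 3
      by (simp add: m'_def numeral_eq_Suc)
    have "(num_born_by a + 2)\<^sup>2 \<le> num_born_by (a + 2)"
      by (rule num_born_by_ge_square_2)
    moreover have "4 \<le> num_born_by a"
      using num_born_by_mono[of 1 a] num_born_by_Suc_0_ge 3 by simp
    then have "8 * num_born_by a + 4 \<le> (num_born_by a + 2)\<^sup>2"
      by (simp add: power2_eq_square algebra_simps)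
    ultimately have "8 * num_born_by a + 4 \<le> num_born_by (a + 2)" by linarith
    moreover have "num_born_by (a + 1) \<le> num_born_by (a + 2)"
      by (rule num_born_by_mono) simp
    moreover have "a \<le> num_born_by a" by (rule num_born_by_ge)
    moreover note \<open>4 \<le> num_born_by a\<close>
    \<comment> \<open>Both \<open>8 * num_born_by a\<close> and \<open>8 * a\<close> are at most
      \<open>num_born_by (a + 2) - 4\<close>, and the two layers of choices cost at most four times
      \<open>num_born_by (a + 2)\<close>. The factor 8 leaves room for the constants.\<close>
    ultimately have "m' + b + 1 \<le> 8 * num_born_by b"
      using m(2) 3(1) by (simp add: m'_def)
    with \<open>has_universal (b + 1) m'\<close> show ?thesis by blast
  qed
qed

lemma twice_max_min_vertices_less:
  assumes "1 \<le> b"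
  shows "2 * max_min_vertices b + 2 * b < num_born_by (b + 1)"
proof -
  have bound: "max_min_vertices b \<le> m" if "has_universal b m" for m
    using that max_min_vertices_le order_trans unfolding has_universal_def by blast
  \<comment> \<open>The linear bound is too coarse on small days: with n = 4 for day 1 and n = 9 for
    day 2, 16 n is not below (n + 3)^2. Hence b = 2 and b = 3 use the explicit sizes.\<close>
  have "b = 1 \<or> b = 2 \<or> b = 3 \<or> (\<exists>a. b = a + 1 \<and> 3 \<le> a)" using assms by presburger
  then consider "b = 1" | "b = 2" | "b = 3" | a where "b = a + 1" "3 \<le> a" by blast
  then show ?thesis
  proof cases
    case 1
    have "max_min_vertices b \<le> 2"
      by (rule bound) (use 1 has_universal_1 in simp)
    moreover have "9 \<le> num_born_by (b + 1)"
      using num_born_by_2_ge unfolding 1 one_add_one .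
    ultimately show ?thesis using 1 by simp
  next
    case 2
    \<comment> \<open>The tight case: for \<open>num_born_by 1 = 4\<close> the comparison is 49
      against 2 * 22 + 4 = 48. The weaker square (4 + 2)^2 = 36 would fail.\<close>
    have "(num_born_by 1 + 3)\<^sup>2 \<le> num_born_by 3"
      using num_born_by_ge_square_3[of 1] by (simp add: numeral_3_eq_3)
    then have "num_born_by 1 * num_born_by 1 + 6 * num_born_by 1 + 9 \<le> num_born_by 3"
      by (simp add: power2_eq_square algebra_simps)
    moreover have "4 * num_born_by 1 \<le> num_born_by 1 * num_born_by 1" "4 \<le> num_born_by 1"
      using num_born_by_Suc_0_ge by auto
    moreover have "max_min_vertices b \<le> 14 + 2 * num_born_by 1"
      by (rule bound) (use 2 has_universal_2 in simp)
    ultimately have "2 * max_min_vertices b + 4 < num_born_by 3" by linarith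
    then show ?thesis using 2 by simp
  next
    case 3
    have "(num_born_by 2 + 3)\<^sup>2 \<le> num_born_by 4"
      using num_born_by_ge_square_3[of 2] by simp
    then have "num_born_by 2 * num_born_by 2 + 6 * num_born_by 2 + 9 \<le> num_born_by 4"
      by (simp add: power2_eq_square algebra_simps)
    moreover have "9 * num_born_by 2 \<le> num_born_by 2 * num_born_by 2"
      using num_born_by_2_ge by auto
    moreover have "max_min_vertices b \<le> 30 + 2 * num_born_by 1 + 2 * num_born_by 2"
      by (rule bound) (use 3 has_universal_3 in simp)
    ultimately have "2 * max_min_vertices b + 6 < num_born_by 4"
      using num_born_by_2_ge num_born_by_mono[of 1 2] by linarith
    then show ?thesis using 3 by simp
  next
    case 4
    then obtain m where m: "has_universal b m" "m + b \<le> 8 * num_born_by a"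
      using has_universal_linear[of a] by auto
    have "(num_born_by a + 3)\<^sup>2 \<le> num_born_by (b + 1)"
      using num_born_by_ge_square_3[of a] 4 by simp
    then have "num_born_by a * num_born_by a + 6 * num_born_by a + 9 \<le> num_born_by (b + 1)"
      by (simp add: power2_eq_square algebra_simps)
    moreover have "49 * num_born_by a \<le> num_born_by a * num_born_by a"
      using num_born_by_ge_49[OF 4(2)] by simp
    ultimately show ?thesis using bound[OF m(1)] m(2) by linarith
  qed
qed

theorem theorem14:
  fixes b :: nat
  assumes "b \<ge> 1"
  shows "real (max_min_vertices b) < 1 / 2 * real (num_born_by (b + 1)) - real b"
  using twice_max_min_vertices_less[OF assms] by linarith

end
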